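(* Let $s\in[0,1]$ and let $\Theta\subseteq\mathbb{S}^1$ satisfy $\dim_{\mathrm{qA}}\Theta=s$. Let $p\in[1,\infty]$ and suppose that for all $\epsilon>0$ there exists $C_\epsilon\ge1$ such that $$\|\mathcal{N}_{\Theta;\delta}f\|_{L^p(\mathbb{R}^2)}\le C_\epsilon\delta^{-\epsilon}\|f\|_{L^p(\mathbb{R}^2)}$$ for all $\delta\in(0,1)$ and all $f\in L^p(\mathbb{R}^2)$. Then $p\ge1+s$.
   Context: A $\delta$-tube in $\mathbb{R}^2$ is the closed $(\delta/2)$-neighbourhood of a unit line segment; its centre $x(T)$ is the midpoint of the segment and its direction $\omega(T)\in\mathbb{S}^1$ is the direction of the segment. For $\Theta\subseteq\mathbb{S}^1$ and $\delta\in(0,1)$, the Nikodým maximal operator restricted to $\Theta$ is $$\mathcal{N}_{\Theta;\delta}f(x):=\sup_{x(T)=x,\ \omega(T)\in\Theta}\frac{1}{\mathrm{Leb}(T)}\int_T|f(y)|\,dy,\qquad f\in L^1_{\mathrm{loc}}(\mathbb{R}^2),$$ the supremum being over all $\delta$-tubes $T$ with centre $x$ and direction in $\Theta$. Quasi-Assouad dimension: for a bounded set $A\subset\mathbb{R}^d$ and $r>0$, let $|A|_r$ be the minimal number of closed $r$-balls needed to cover $A$. For non-empty $E\subseteq\mathbb{R}^d$ and $\gamma\in(0,1)$ let $$h_E(\gamma):=\inf\{\alpha:\ \exists C>0\text{ such that for all }0<r<r^{1-\gamma}<R\text{ and }x\in E,\ |B(x,R)\cap E|_r\le C(R/r)^\alpha\},$$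 and $\dim_{\mathrm{qA}}E:=\lim_{\gamma\to0^+}h_E(\gamma)$; also $\dim_{\mathrm{qA}}\varnothing:=0$. *)

theory Defs
  imports "HOL-Analysis.Analysis" "HOL-Probability.Essential_Supremum"
begin

section \<open>Quasi-Assouad dimension\<close>

text \<open>The balls need not be centred in \<open>A\<close>. The value is only meaningful for bounded \<open>A\<close> and
  \<open>r > 0\<close>.\<close>

definition covering_num :: "real \<Rightarrow> 'a::euclidean_space set \<Rightarrow> nat" where
  "covering_num r A =
     (LEAST n. \<exists>X. finite X \<and> card X = n \<and> A \<subseteq> (\<Union>x\<in>X. cball x r))"

text \<open>For non-empty \<open>E\<close> and \<open>\<gamma> \<in> (0,1)\<close> the set of admissible exponents is non-empty and
  bounded below by \<open>0\<close> (there is no upper bound on \<open>R\<close>, and \<open>R / r\<close> is unbounded), so the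
  infimum is a genuine one.\<close>

definition qA_exponent :: "'a::euclidean_space set \<Rightarrow> real \<Rightarrow> real" where
  "qA_exponent E \<gamma> = Inf {\<alpha>. \<exists>C>0. \<forall>r R. 0 < r \<and> r < r powr (1 - \<gamma>) \<and> r powr (1 - \<gamma>) < R \<longrightarrow>
     (\<forall>x\<in>E. real (covering_num r (cball x R \<inter> E)) \<le> C * (R / r) powr \<alpha>)}"

text \<open>For non-empty \<open>E\<close> the limit exists, because \<open>qA_exponent E\<close> is bounded and antitone
  on \<open>(0,1)\<close>.\<close>

definition quasi_Assouad_dim :: "'a::euclidean_space set \<Rightarrow> real" where
  "quasi_Assouad_dim E = (if E = {} then 0 else Lim (at_right 0) (qA_exponent E))"


section \<open>The directional Nikodym maximal operator\<close>

text \<open>The \<open>\<delta>\<close>-tube with centre \<open>x\<close> and direction \<open>\<omega>\<close>, where \<open>\<omega>\<close> is a unit vector.\<close>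

definition tube :: "real \<Rightarrow> real^2 \<Rightarrow> real^2 \<Rightarrow> (real^2) set" where
  "tube \<delta> x \<omega> =
     {y. infdist y (closed_segment (x - (1/2) *\<^sub>R \<omega>) (x + (1/2) *\<^sub>R \<omega>)) \<le> \<delta> / 2}"

definition nikodym_max :: "(real^2) set \<Rightarrow> real \<Rightarrow> (real^2 \<Rightarrow> real) \<Rightarrow> real^2 \<Rightarrow> ennreal" where
  "nikodym_max \<Theta> \<delta> f x =
     (SUP \<omega>\<in>\<Theta>. (\<integral>\<^sup>+ y \<in> tube \<delta> x \<omega>. ennreal \<bar>f y\<bar> \<partial>lebesgue) / emeasure lebesgue (tube \<delta> x \<omega>))"


section \<open>Lebesgue norms\<close>

text \<open>Power with a positive real exponent.\<close>

definition ennreal_powr :: "ennreal \<Rightarrow> real \<Rightarrow> ennreal" where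
  "ennreal_powr x a = (if x = \<infinity> then \<infinity> else ennreal (enn2real x powr a))"

text \<open>The norm is defined for functions with values in \<open>[0,\<infinity>]\<close>, as produced by
  \<^const>\<open>nikodym_max\<close>; for real-valued \<open>f\<close> it is applied to \<open>\<bar>f\<bar>\<close>.\<close>

definition Lp_norm :: "ennreal \<Rightarrow> 'a measure \<Rightarrow> ('a \<Rightarrow> ennreal) \<Rightarrow> ennreal" where
  "Lp_norm p M g =
     (if p = \<infinity> then esssup M g
      else ennreal_powr (\<integral>\<^sup>+ x. ennreal_powr (g x) (enn2real p) \<partial>M) (1 / enn2real p))"

definition Lp_space :: "ennreal \<Rightarrow> 'a measure \<Rightarrow> ('a \<Rightarrow> real) set" where
  "Lp_space p M = {f \<in> borel_measurable M. Lp_norm p M (\<lambda>x. ennreal \<bar>f x\<bar>) < \<infinity>}"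

end

theory Submission
  imports Defs
begin

text \<open>Test the maximal inequality on a box adapted to a cap of directions. Fix \<open>e \<in> \<Theta>\<close> and scales
  \<open>r < R\<close>, and choose \<open>r\<close>-separated directions \<open>\<omega>\<^sub>1, \<dots>, \<omega>\<^sub>N\<close> in \<open>\<Theta>\<close> within distance \<open>R\<close> of \<open>e\<close>. Near the
  origin, more precisely at distance up to about \<open>r / R\<close>, the \<open>r\<close>-tubes through the origin with these
  directions cannot be told apart: they all contain a box \<open>Q\<close> of dimensions about
  \<open>r / R \<times> r\<close> pointing along \<open>e\<close> (\<open>oriented_box_subset_tube\<close>). Beyond distance \<open>1/4\<close> from the
  origin, however, the separation makes their cores of width \<open>r/8\<close> disjoint
  (\<open>oriented_boxes_disjoint\<close>). A tube recentred at such a point of its core still contains \<open>Q\<close>. Hence,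
  for \<open>f\<close> the indicator function of \<open>Q\<close>, the maximal function is at least about \<open>\<bar>Q\<bar> / r\<close>, that is
  \<open>r / R\<close>, on a set of measure about \<open>N r\<close>, whereas \<open>\<bar>Q\<bar>\<close> is about \<open>r\<^sup>2 / R\<close>. If the operator norm on \<open>L\<^sup>q\<close> is at
  most \<open>K\<close>, comparing the two sides gives, up to constants,
  \<open>N \<le> K\<^sup>q (R / r) powr (q - 1)\<close> (\<open>covering_num_directions_le\<close>). Taking the separated set maximal
  turns this into a bound for covering numbers.

  For \<open>K = C r powr (-\<epsilon>)\<close> the loss is absorbed thanks to the quasi-Assouad restriction
  \<open>R > r powr (1 - \<gamma>)\<close>, which says \<open>r powr (-\<gamma>) < R / r\<close>: a small negative power of \<open>r\<close> is a small power
  of \<open>R / r\<close>. So every exponent above \<open>q - 1\<close> is admissible for every \<open>\<gamma>\<close>, and the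
  quasi-Assouad dimension is at most \<open>q - 1\<close> (\<open>quasi_Assouad_dim_le\<close>). The cases \<open>p = \<infinity>\<close> and
  \<open>\<Theta> = {}\<close> are immediate.\<close>

section \<open>Orthonormal frames and oriented boxes in the plane\<close>

definition perp :: "real^2 \<Rightarrow> real^2" where
  "perp v = vector [- (v $ 2), v $ 1]"

lemma inner_perp_perp [simp]: "perp u \<bullet> perp v = u \<bullet> v"
  by (simp add: perp_def inner_vec_def sum_2)

lemma inner_perp_self [simp]: "v \<bullet> perp v = 0" "perp v \<bullet> v = 0"
  by (simp_all add: perp_def inner_vec_def sum_2)

lemma norm_perp [simp]: "norm (perp v) = norm v"
  by (simp add: norm_eq_sqrt_inner)

lemma perp_diff: "perp (u - v) = perp u - perp v"
  by (simp add: perp_def vec_eq_iff forall_2)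

lemma frame_decomposition:
  assumes "norm \<omega> = 1"
  shows "y = (y \<bullet> \<omega>) *\<^sub>R \<omega> + (y \<bullet> perp \<omega>) *\<^sub>R perp \<omega>"
proof -
  have w: "\<omega> $ 1 * \<omega> $ 1 + \<omega> $ 2 * \<omega> $ 2 = 1"
    using assms by (simp add: norm_eq_1 inner_vec_def sum_2)
  have "y $ 1 = (y $ 1 * \<omega> $ 1 + y $ 2 * \<omega> $ 2) * \<omega> $ 1 - (- (y $ 1 * \<omega> $ 2) + y $ 2 * \<omega> $ 1) * \<omega> $ 2"
    using w by algebra
  moreover have "y $ 2 = (y $ 1 * \<omega> $ 1 + y $ 2 * \<omega> $ 2) * \<omega> $ 2 + (- (y $ 1 * \<omega> $ 2) + y $ 2 * \<omega> $ 1) * \<omega> $ 1"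
    using w by algebra
  ultimately show ?thesis
    by (simp add: perp_def vec_eq_iff forall_2 inner_vec_def sum_2)
qed

definition oriented_box :: "real^2 \<Rightarrow> real \<Rightarrow> real \<Rightarrow> real \<Rightarrow> real \<Rightarrow> (real^2) set" where
  "oriented_box \<omega> a b c d = {y. y \<bullet> \<omega> \<in> {a..b} \<and> y \<bullet> perp \<omega> \<in> {c..d}}"

lemma oriented_box_eq_image:
  assumes "norm \<omega> = 1"
  shows "oriented_box \<omega> a b c d =
    (\<lambda>v::real^2. (v $ 1) *\<^sub>R \<omega> + (v $ 2) *\<^sub>R perp \<omega>) ` cbox (vector [a, c]) (vector [b, d])"
    (is "_ = ?f ` _")
proof -
  have coords: "?f v \<bullet> \<omega> = v $ 1" "?f v \<bullet> perp \<omega> = v $ 2" for v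
    using assms by (simp_all add: inner_add_left norm_eq_1)
  show ?thesis
  proof (intro equalityI subsetI)
    fix y assume y: "y \<in> oriented_box \<omega> a b c d"
    have "y = ?f (vector [y \<bullet> \<omega>, y \<bullet> perp \<omega>] :: real^2)"
      using frame_decomposition[OF assms, of y] by simp
    moreover have "vector [y \<bullet> \<omega>, y \<bullet> perp \<omega>] \<in> cbox (vector [a, c]) (vector [b, d] :: real^2)"
      using y by (simp add: oriented_box_def mem_box_cart forall_2)
    ultimately show "y \<in> ?f ` cbox (vector [a, c]) (vector [b, d])"
      by (rule image_eqI)
  next
    fix y assume "y \<in> ?f ` cbox (vector [a, c]) (vector [b, d])"
    then show "y \<in> oriented_box \<omega> a b c d"
      by (auto simp: oriented_box_def coords mem_box_cart forall_2)
  qed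
qed

lemma oriented_box_measure:
  assumes "norm \<omega> = 1" "a \<le> b" "c \<le> d"
  shows "oriented_box \<omega> a b c d \<in> lmeasurable"
    and "measure lebesgue (oriented_box \<omega> a b c d) = (b - a) * (d - c)"
proof -
  let ?f = "\<lambda>v::real^2. (v $ 1) *\<^sub>R \<omega> + (v $ 2) *\<^sub>R perp \<omega>"
  have "linear ?f"
    by (rule linearI) (simp_all add: algebra_simps)
  moreover have "?f v \<bullet> ?f w = v \<bullet> w" for v w
    using assms(1) by (simp add: inner_add_left inner_add_right norm_eq_1)
      (simp add: inner_vec_def sum_2)
  ultimately have orth: "orthogonal_transformation ?f"
    by (simp add: orthogonal_transformation_def)
  have "measure lebesgue (cbox (vector [a, c]) (vector [b, d] :: real^2)) = (b - a) * (d - c)"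
    using assms(2,3) interval_ne_empty_cart(1)[of "vector [a, c] :: real^2" "vector [b, d]"]
    by (simp add: measure_completion content_cbox_cart forall_2 UNIV_2)
  then show "oriented_box \<omega> a b c d \<in> lmeasurable"
    and "measure lebesgue (oriented_box \<omega> a b c d) = (b - a) * (d - c)"
    unfolding oriented_box_eq_image[OF assms(1)]
    using measurable_orthogonal_image[OF orth lmeasurable_cbox]
      measure_orthogonal_image[OF orth lmeasurable_cbox] by auto
qed

lemma emeasure_oriented_box:
  assumes "norm \<omega> = 1" "a \<le> b" "c \<le> d"
  shows "emeasure lebesgue (oriented_box \<omega> a b c d) = ennreal ((b - a) * (d - c))"
  using oriented_box_measure[OF assms] by (simp add: emeasure_eq_measure2)

section \<open>Tubes\<close>

text \<open>A tube contains the rectangle of length \<open>1\<close> and width \<open>\<delta>\<close> around its axis. Together with the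
  inclusion in a slightly longer rectangle below, this replaces the round ends of the tube by
  coordinate conditions.\<close>

lemma mem_tubeI:
  assumes "norm \<omega> = 1" "\<bar>(y - x) \<bullet> \<omega>\<bar> \<le> 1/2" "\<bar>(y - x) \<bullet> perp \<omega>\<bar> \<le> \<delta> / 2"
  shows "y \<in> tube \<delta> x \<omega>"
proof -
  let ?t = "(y - x) \<bullet> \<omega>"
  have "x + ?t *\<^sub>R \<omega> \<in> closed_segment (x - (1/2) *\<^sub>R \<omega>) (x + (1/2) *\<^sub>R \<omega>)"
    unfolding in_segment
    using assms(2) by (intro exI[of _ "?t + 1/2"]) (auto simp: vec_eq_iff field_simps)
  moreover have "y - (x + ?t *\<^sub>R \<omega>) = ((y - x) \<bullet> perp \<omega>) *\<^sub>R perp \<omega>"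
    using frame_decomposition[OF assms(1), of "y - x"] by (simp add: algebra_simps)
  then have "dist y (x + ?t *\<^sub>R \<omega>) \<le> \<delta> / 2"
    using assms(1,3) by (simp add: dist_norm)
  ultimately show ?thesis
    unfolding tube_def using infdist_le2 by blast
qed

lemma tube_subset_oriented_box:
  assumes "norm \<omega> = 1"
  shows "tube \<delta> x \<omega> \<subseteq> oriented_box \<omega> (x \<bullet> \<omega> - (1 + \<delta>)/2) (x \<bullet> \<omega> + (1 + \<delta>)/2)
    (x \<bullet> perp \<omega> - \<delta>/2) (x \<bullet> perp \<omega> + \<delta>/2)"
proof
  fix y assume y: "y \<in> tube \<delta> x \<omega>"
  let ?S = "closed_segment (x - (1/2) *\<^sub>R \<omega>) (x + (1/2) *\<^sub>R \<omega>)"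
  obtain z where z: "z \<in> ?S" "infdist y ?S = dist y z"
    using infdist_attains_inf[of ?S y] by auto
  then obtain t where t: "0 \<le> t" "t \<le> 1"
      "z = (1 - t) *\<^sub>R (x - (1/2) *\<^sub>R \<omega>) + t *\<^sub>R (x + (1/2) *\<^sub>R \<omega>)"
    by (auto simp: in_segment)
  have z_eq: "z = x + (t - 1/2) *\<^sub>R \<omega>"
    unfolding t(3) by (simp add: vec_eq_iff field_simps)
  have d: "norm (y - z) \<le> \<delta> / 2"
    using y z by (simp add: tube_def dist_norm)
  have "\<bar>(y - z) \<bullet> \<omega>\<bar> \<le> \<delta> / 2" "\<bar>(y - z) \<bullet> perp \<omega>\<bar> \<le> \<delta> / 2"
    using d Cauchy_Schwarz_ineq2[of "y - z" \<omega>] Cauchy_Schwarz_ineq2[of "y - z" "perp \<omega>"] assms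
    by auto
  moreover have "z \<bullet> \<omega> = x \<bullet> \<omega> + (t - 1/2)" "z \<bullet> perp \<omega> = x \<bullet> perp \<omega>"
    using assms by (simp_all add: z_eq inner_add_left norm_eq_1)
  ultimately show "y \<in> oriented_box \<omega> (x \<bullet> \<omega> - (1 + \<delta>)/2) (x \<bullet> \<omega> + (1 + \<delta>)/2)
    (x \<bullet> perp \<omega> - \<delta>/2) (x \<bullet> perp \<omega> + \<delta>/2)"
    using t(1,2) unfolding oriented_box_def mem_Collect_eq atLeastAtMost_iff
      inner_diff_left add_divide_distrib
    by (intro conjI; linarith)
qed

lemma emeasure_tube_le:
  assumes "norm \<omega> = 1" "0 < \<delta>" "\<delta> < 1"
  shows "emeasure lebesgue (tube \<delta> x \<omega>) \<le> ennreal (2 * \<delta>)"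
proof -
  have "emeasure lebesgue (tube \<delta> x \<omega>) \<le> emeasure lebesgue
      (oriented_box \<omega> (x \<bullet> \<omega> - (1 + \<delta>)/2) (x \<bullet> \<omega> + (1 + \<delta>)/2)
        (x \<bullet> perp \<omega> - \<delta>/2) (x \<bullet> perp \<omega> + \<delta>/2))"
    using assms by (intro emeasure_mono tube_subset_oriented_box fmeasurableD oriented_box_measure)
      (auto simp: add_divide_distrib)
  also have "\<dots> = ennreal ((1 + \<delta>) * \<delta>)"
    using assms(2) by (subst emeasure_oriented_box[OF assms(1)]) (simp_all add: add_divide_distrib)
  also have "\<dots> \<le> ennreal (2 * \<delta>)"
    using assms by (intro ennreal_leI mult_right_mono) auto
  finally show ?thesis .
qed

section \<open>Lower bounds for the maximal function and weak-type consequences\<close>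

lemma ennreal_inverse_antimono: "x \<le> y \<Longrightarrow> inverse y \<le> inverse (x::ennreal)"
  by (simp add: less_eq_ennreal.rep_eq inverse_ennreal.rep_eq ereal_inverse_antimono)

lemma nikodym_max_indicator_ge:
  assumes "\<omega> \<in> \<Theta>" "norm \<omega> = 1" "0 < \<delta>" "\<delta> < 1" "Q \<in> lmeasurable" "Q \<subseteq> tube \<delta> x \<omega>"
  shows "ennreal (measure lebesgue Q / (2 * \<delta>)) \<le> nikodym_max \<Theta> \<delta> (indicator Q) x"
proof -
  have "(\<integral>\<^sup>+ y \<in> tube \<delta> x \<omega>. ennreal \<bar>indicator Q y\<bar> \<partial>lebesgue)
      = (\<integral>\<^sup>+ y. indicator Q y \<partial>lebesgue)"
    using assms(6) by (intro nn_integral_cong) (auto simp: indicator_def)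
  also have "\<dots> = ennreal (measure lebesgue Q)"
    using assms(5) by (simp add: fmeasurableD emeasure_eq_measure2)
  finally have int: "(\<integral>\<^sup>+ y \<in> tube \<delta> x \<omega>. ennreal \<bar>indicator Q y\<bar> \<partial>lebesgue)
      = ennreal (measure lebesgue Q)" .
  have "ennreal (measure lebesgue Q / (2 * \<delta>)) = ennreal (measure lebesgue Q) / ennreal (2 * \<delta>)"
    using assms(3) by (simp add: divide_ennreal)
  also have "\<dots> \<le> ennreal (measure lebesgue Q) / emeasure lebesgue (tube \<delta> x \<omega>)"
    unfolding divide_ennreal_def
    by (intro mult_left_mono ennreal_inverse_antimono emeasure_tube_le assms) simp
  also have "\<dots> \<le> nikodym_max \<Theta> \<delta> (indicator Q) x"
    unfolding nikodym_max_def int[symmetric] using assms(1) by (rule SUP_upper)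
  finally show ?thesis .
qed

lemma ennreal_powr_ennreal: "0 \<le> x \<Longrightarrow> ennreal_powr (ennreal x) a = ennreal (x powr a)"
  by (simp add: ennreal_powr_def)

lemma ennreal_powr_mono: "x \<le> y \<Longrightarrow> 0 \<le> a \<Longrightarrow> ennreal_powr x a \<le> ennreal_powr y a"
  by (auto simp: ennreal_powr_def top_unique less_top intro!: ennreal_leI powr_mono2 enn2real_mono)

lemma Lp_norm_mono:
  assumes "\<And>x. g x \<le> h x" "p \<noteq> \<infinity>"
  shows "Lp_norm p M g \<le> Lp_norm p M h"
  using assms by (auto simp: Lp_norm_def intro!: ennreal_powr_mono nn_integral_mono)

lemma Lp_norm_indicator:
  assumes "0 < q" "A \<in> fmeasurable M" "0 \<le> c"
  shows "Lp_norm (ennreal q) M (\<lambda>x. ennreal (c * indicator A x)) = ennreal (c * measure M A powr (1/q))"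
proof -
  have "(\<integral>\<^sup>+ x. ennreal_powr (ennreal (c * indicator A x)) q \<partial>M)
      = (\<integral>\<^sup>+ x. ennreal (c powr q) * indicator A x \<partial>M)"
    using assms by (intro nn_integral_cong) (auto simp: indicator_def ennreal_powr_ennreal)
  also have "\<dots> = ennreal (c powr q * measure M A)"
    using assms by (simp add: nn_integral_cmult_indicator fmeasurableD emeasure_eq_measure2 ennreal_mult)
  finally show ?thesis
    using assms by (simp add: Lp_norm_def ennreal_powr_ennreal powr_mult powr_powr)
qed

text \<open>Chebyshev's inequality. The function \<open>g\<close> is only compared with a multiple of the indicator
  function of \<open>G\<close>, so the lemma applies directly to \<open>nikodym_max\<close>, a supremum over a possibly
  uncountable set of directions.\<close>

lemma weak_type_of_Lp_bound:
  assumes "0 < q" and K: "0 \<le> K" and "A \<in> fmeasurable M" "G \<in> fmeasurable M" "0 \<le> \<tau>"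
    and bound: "Lp_norm (ennreal q) M g \<le> ennreal K * Lp_norm (ennreal q) M (\<lambda>x. ennreal \<bar>indicator A x\<bar>)"
    and lower: "\<And>x. x \<in> G \<Longrightarrow> ennreal \<tau> \<le> g x"
  shows "\<tau> powr q * measure M G \<le> K powr q * measure M A"
proof -
  have "ennreal (\<tau> * measure M G powr (1/q)) = Lp_norm (ennreal q) M (\<lambda>x. ennreal (\<tau> * indicator G x))"
    using assms by (simp add: Lp_norm_indicator)
  also have "\<dots> \<le> Lp_norm (ennreal q) M g"
    using lower by (intro Lp_norm_mono) (auto simp: indicator_def)
  also note bound
  also have "Lp_norm (ennreal q) M (\<lambda>x. ennreal \<bar>indicator A x\<bar>) = ennreal (measure M A powr (1/q))"
    using Lp_norm_indicator[OF assms(1,3), of 1] by simp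
  finally have "\<tau> * measure M G powr (1/q) \<le> K * measure M A powr (1/q)"
    using K by (simp add: ennreal_mult[symmetric])
  then have "(\<tau> * measure M G powr (1/q)) powr q \<le> (K * measure M A powr (1/q)) powr q"
    using assms(1,5) by (intro powr_mono2) auto
  then show ?thesis
    using assms(1,5) K by (simp add: powr_mult powr_powr)
qed

section \<open>Counting separated directions\<close>

text \<open>A separated subset of maximal cardinality exists because of the bound \<open>M\<close>, and its \<open>r\<close>-balls
  cover \<open>A\<close>, since any uncovered point could be added to it.\<close>

lemma covering_num_le_of_packing_bound:
  assumes "0 \<le> r" and packing: "\<And>X. finite X \<Longrightarrow> X \<subseteq> A \<Longrightarrow> (\<And>u v. u \<in> X \<Longrightarrow> v \<in> X \<Longrightarrow> u \<noteq> v \<Longrightarrow> r < dist u v)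
      \<Longrightarrow> real (card X) \<le> M"
  shows "real (covering_num r A) \<le> M"
proof -
  define sep where "sep X \<longleftrightarrow> finite X \<and> X \<subseteq> A \<and> (\<forall>u\<in>X. \<forall>v\<in>X. u \<noteq> v \<longrightarrow> r < dist u v)" for X
  have sep_card: "real (card X) \<le> M" if "sep X" for X
    using that packing[of X] by (auto simp: sep_def)
  have bounded: "\<forall>X. sep X \<longrightarrow> card X \<le> nat \<lfloor>M\<rfloor>"
    using sep_card by (simp add: le_nat_floor)
  have "sep {}"
    by (simp add: sep_def)
  with bounded obtain X where X: "sep X" "\<And>Y. sep Y \<Longrightarrow> card Y \<le> card X"
    using ex_has_greatest_nat[of sep "{}" card "Suc (nat \<lfloor>M\<rfloor>)"]
    by (auto simp: less_Suc_eq_le)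
  have "A \<subseteq> (\<Union>x\<in>X. cball x r)"
  proof (rule ccontr)
    assume "\<not> A \<subseteq> (\<Union>x\<in>X. cball x r)"
    then obtain a where a: "a \<in> A" "\<forall>x\<in>X. r < dist x a"
      unfolding subset_iff UN_iff mem_cball not_le[symmetric] by blast
    show False
    proof (cases "a \<in> X")
      case True
      then show False
        using a \<open>0 \<le> r\<close> by force
    next
      case False
      then have "sep (insert a X)"
        using X(1) a by (auto simp: sep_def dist_commute)
      then show False
        using X(2)[of "insert a X"] X(1) False by (simp add: sep_def)
    qed
  qed
  then have "covering_num r A \<le> card X"
    unfolding covering_num_def using X(1) by (intro Least_le) (auto simp: sep_def)
  then show ?thesis
    using sep_card[OF X(1)] by linarith
qed

text \<open>A direction \<open>\<omega>\<close> at distance at most \<open>R\<close> from \<open>e\<close> drifts off the axis of \<open>e\<close> by at most \<open>r/16\<close> over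
  a length \<open>r / (16 R)\<close>; the transverse extent \<open>r/16\<close> of the box contributes a further \<open>r/8\<close> at most,
  because two unit vectors are never more than \<open>2\<close> apart. The short box around the origin along \<open>e\<close>
  therefore lies within \<open>r/4\<close> of the line through the origin along \<open>\<omega>\<close>. A tube along \<open>\<omega>\<close> whose centre
  is within \<open>r/16\<close> of this line, and at most \<open>3/8\<close> away from the origin along it, contains the box.\<close>

lemma oriented_box_subset_tube:
  assumes norms: "norm e = 1" "norm \<omega> = 1" and dist: "dist e \<omega> \<le> R"
    and r: "0 < r" "r < 1" "r < R"
    and x: "x \<in> oriented_box \<omega> (1/4) (3/8) (-r/16) (r/16)"
  shows "oriented_box e (- r / (16 * R)) (r / (16 * R)) (-r/16) (r/16) \<subseteq> tube r x \<omega>"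
proof
  fix y assume y: "y \<in> oriented_box e (- r / (16 * R)) (r / (16 * R)) (-r/16) (r/16)"
  then have y1: "\<bar>y \<bullet> e\<bar> \<le> r / (16 * R)" and y2: "\<bar>y \<bullet> perp e\<bar> \<le> r / 16"
    by (auto simp: oriented_box_def abs_le_iff)
  have "r / (16 * R) \<le> 1/16"
    using r by (simp add: field_simps)
  have expand: "y \<bullet> v = (y \<bullet> e) * (e \<bullet> v) + (y \<bullet> perp e) * (perp e \<bullet> v)" for v
    by (subst frame_decomposition[OF norms(1), of y]) (simp add: inner_add_left)
  have "\<bar>e \<bullet> \<omega>\<bar> \<le> 1" "\<bar>perp e \<bullet> \<omega>\<bar> \<le> 1"
    using Cauchy_Schwarz_ineq2[of e \<omega>] Cauchy_Schwarz_ineq2[of "perp e" \<omega>] norms by auto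
  then have "\<bar>(y \<bullet> e) * (e \<bullet> \<omega>)\<bar> \<le> \<bar>y \<bullet> e\<bar> * 1" "\<bar>(y \<bullet> perp e) * (perp e \<bullet> \<omega>)\<bar> \<le> \<bar>y \<bullet> perp e\<bar> * 1"
    unfolding abs_mult by (intro mult_left_mono; simp)+
  then have along: "\<bar>y \<bullet> \<omega>\<bar> \<le> 1/8"
    using expand[of \<omega>] y1 y2 r \<open>r / (16 * R) \<le> 1/16\<close> by linarith
  let ?d = "perp \<omega> - perp e"
  have d: "norm ?d = dist e \<omega>"
    by (simp add: perp_diff[symmetric] dist_norm norm_minus_commute)
  have "norm ?d \<le> 2"
    using norm_triangle_ineq4[of "perp \<omega>" "perp e"] norms by simp
  then have "\<bar>e \<bullet> ?d\<bar> \<le> R" "\<bar>perp e \<bullet> ?d\<bar> \<le> 2"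
    using Cauchy_Schwarz_ineq2[of e ?d] Cauchy_Schwarz_ineq2[of "perp e" ?d] norms d dist by auto
  then have "\<bar>(y \<bullet> e) * (e \<bullet> ?d)\<bar> \<le> r / (16 * R) * R" "\<bar>(y \<bullet> perp e) * (perp e \<bullet> ?d)\<bar> \<le> r / 16 * 2"
    unfolding abs_mult by (intro mult_mono; use y1 y2 r in simp)+
  moreover have "r / (16 * R) * R = r / 16"
    using r by simp
  ultimately have "\<bar>y \<bullet> ?d\<bar> \<le> 3 * r / 16"
    using expand[of ?d] by linarith
  then have across: "\<bar>y \<bullet> perp \<omega>\<bar> \<le> r / 4"
    using y2 unfolding inner_diff_right by linarith
  show "y \<in> tube r x \<omega>"
    using x along across r
    unfolding oriented_box_def mem_Collect_eq atLeastAtMost_iff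
    by (intro mem_tubeI norms; unfold inner_diff_left; linarith)
qed

text \<open>A common point is within \<open>r/16\<close> of points \<open>a \<omega>\<close> and \<open>a' \<omega>'\<close> with \<open>a, a' \<ge> 1/4\<close>. These two points are
  at most \<open>r/8\<close> apart, and so are their norms \<open>a\<close> and \<open>a'\<close>; hence the distance between \<open>\<omega>\<close> and \<open>\<omega>'\<close> is
  at most \<open>4 (r/8 + r/8) = r\<close>.\<close>

lemma oriented_boxes_disjoint:
  assumes norms: "norm \<omega> = 1" "norm \<omega>' = 1" and "r < dist \<omega> \<omega>'"
  shows "oriented_box \<omega> (1/4) (3/8) (-r/16) (r/16) \<inter> oriented_box \<omega>' (1/4) (3/8) (-r/16) (r/16) = {}"
proof (rule ccontr)
  assume "\<not> ?thesis"
  then obtain x where x: "x \<in> oriented_box \<omega> (1/4) (3/8) (-r/16) (r/16)"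
      "x \<in> oriented_box \<omega>' (1/4) (3/8) (-r/16) (r/16)"
    by blast
  define a b a' b' where "a = x \<bullet> \<omega>" "b = x \<bullet> perp \<omega>" "a' = x \<bullet> \<omega>'" "b' = x \<bullet> perp \<omega>'"
  note defs = this
  have range: "1/4 \<le> a" "1/4 \<le> a'" "\<bar>b\<bar> \<le> r/16" "\<bar>b'\<bar> \<le> r/16"
    using x by (auto simp: oriented_box_def defs abs_le_iff)
  have "a *\<^sub>R \<omega> + b *\<^sub>R perp \<omega> = a' *\<^sub>R \<omega>' + b' *\<^sub>R perp \<omega>'"
    using frame_decomposition[OF norms(1), of x] frame_decomposition[OF norms(2), of x]
    by (simp add: defs)
  then have "a *\<^sub>R \<omega> - a' *\<^sub>R \<omega>' = b' *\<^sub>R perp \<omega>' - b *\<^sub>R perp \<omega>"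
    by (simp add: algebra_simps)
  then have close: "norm (a *\<^sub>R \<omega> - a' *\<^sub>R \<omega>') \<le> r / 8"
    using norm_triangle_ineq4[of "b' *\<^sub>R perp \<omega>'" "b *\<^sub>R perp \<omega>"] norms range by simp
  have "\<bar>a' - a\<bar> \<le> r / 8"
    using norm_triangle_ineq3[of "a *\<^sub>R \<omega>" "a' *\<^sub>R \<omega>'"] norms range close
    by (simp add: abs_minus_commute)
  moreover have "a *\<^sub>R (\<omega> - \<omega>') = (a *\<^sub>R \<omega> - a' *\<^sub>R \<omega>') + (a' - a) *\<^sub>R \<omega>'"
    by (simp add: algebra_simps)
  then have "norm (a *\<^sub>R (\<omega> - \<omega>')) \<le> norm (a *\<^sub>R \<omega> - a' *\<^sub>R \<omega>') + norm ((a' - a) *\<^sub>R \<omega>')"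
    by (metis norm_triangle_ineq)
  ultimately have "a * dist \<omega> \<omega>' \<le> r / 4"
    using close norms range by (simp add: dist_norm)
  moreover have "1/4 * dist \<omega> \<omega>' \<le> a * dist \<omega> \<omega>'"
    using range by (intro mult_right_mono) auto
  ultimately show False
    using assms(3) by linarith
qed

text \<open>The quantitative heart of the argument: an \<open>L\<^sup>q\<close> bound at a single scale \<open>r\<close> limits the
  number of \<open>r\<close>-separated directions in a cap of any radius \<open>R > r\<close>. The factor \<open>128\<close> is the constant in
  the lower bound \<open>r / (128 R)\<close> for the maximal function of the test box.\<close>

lemma covering_num_directions_le:
  assumes \<Theta>: "\<Theta> \<subseteq> sphere 0 1" and e: "e \<in> \<Theta>" and r: "0 < r" "r < 1" "r < R"
    and q: "1 \<le> q" and K: "0 \<le> K"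
    and bound: "\<And>f. f \<in> Lp_space (ennreal q) lebesgue \<Longrightarrow> Lp_norm (ennreal q) lebesgue (nikodym_max \<Theta> r f)
        \<le> ennreal K * Lp_norm (ennreal q) lebesgue (\<lambda>x. ennreal \<bar>f x\<bar>)"
  shows "real (covering_num r (cball e R \<inter> \<Theta>)) \<le> (128 * K) powr q * (R / r) powr (q - 1)"
proof (rule covering_num_le_of_packing_bound)
  show "0 \<le> r" using r by simp
next
  fix X assume X: "finite X" "X \<subseteq> cball e R \<inter> \<Theta>"
    and sep: "\<And>u v. u \<in> X \<Longrightarrow> v \<in> X \<Longrightarrow> u \<noteq> v \<Longrightarrow> r < dist u v"
  \<comment> \<open>\<open>Q\<close> is the support of the test function, \<open>W \<omega>\<close> consists of centres of tubes along \<open>\<omega>\<close> containing \<open>Q\<close>,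
    and \<open>\<tau>\<close> is the area of \<open>Q\<close> divided by the bound \<open>2 r\<close> for the area of a tube.\<close>
  define Q where "Q = oriented_box e (- r / (16 * R)) (r / (16 * R)) (-r/16) (r/16)"
  define W where "W \<omega> = oriented_box \<omega> (1/4) (3/8) (-r/16) (r/16)" for \<omega>
  define \<tau> where "\<tau> = r / (128 * R)"
  have unit: "norm \<omega> = 1" if "\<omega> \<in> \<Theta>" for \<omega>
    using that \<Theta> by auto
  have R: "0 < R" using r by simp
  have Q: "Q \<in> lmeasurable" "measure lebesgue Q = r^2 / (64 * R)"
    unfolding Q_def using r R unit[OF e]
    by (simp_all add: oriented_box_measure power2_eq_square field_simps)
  have W: "W \<omega> \<in> lmeasurable" "measure lebesgue (W \<omega>) = r / 64" if "\<omega> \<in> X" for \<omega>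
    unfolding W_def using r unit[of \<omega>] that X
    by (auto simp: oriented_box_measure)
  have "disjoint_family_on W X"
    unfolding disjoint_family_on_def W_def using X(2) unit sep
    by (intro ballI impI oriented_boxes_disjoint) blast+
  then have "measure lebesgue (\<Union>\<omega>\<in>X. W \<omega>) = (\<Sum>\<omega>\<in>X. measure lebesgue (W \<omega>))"
    using X(1) fmeasurableD[OF W(1)] fmeasurableD2[OF W(1)]
    by (intro measure_finite_Union) (blast, blast, blast, simp)
  also have "\<dots> = real (card X) * (r / 64)"
    by (simp add: W(2) cong: sum.cong)
  finally have union: "measure lebesgue (\<Union>\<omega>\<in>X. W \<omega>) = real (card X) * (r / 64)" .
  have lower: "ennreal \<tau> \<le> nikodym_max \<Theta> r (indicator Q) x" if x: "x \<in> (\<Union>\<omega>\<in>X. W \<omega>)" for x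
  proof -
    obtain \<omega> where \<omega>: "\<omega> \<in> X" "x \<in> W \<omega>" using x by blast
    then have "\<omega> \<in> \<Theta>" "dist e \<omega> \<le> R" using X by auto
    then have "Q \<subseteq> tube r x \<omega>"
      unfolding Q_def using \<omega> r unit e by (intro oriented_box_subset_tube) (auto simp: W_def)
    moreover have "\<tau> = measure lebesgue Q / (2 * r)"
      using r R by (simp add: \<tau>_def Q power2_eq_square)
    ultimately show ?thesis
      using nikodym_max_indicator_ge[OF \<open>\<omega> \<in> \<Theta>\<close> unit[OF \<open>\<omega> \<in> \<Theta>\<close>] r(1,2) Q(1)] by simp
  qed
  have "indicator Q \<in> Lp_space (ennreal q) lebesgue"
    using Lp_norm_indicator[of q Q lebesgue 1] q Q(1) by (auto simp: Lp_space_def less_top)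
  then have "\<tau> powr q * measure lebesgue (\<Union>\<omega>\<in>X. W \<omega>) \<le> K powr q * measure lebesgue Q"
    using q K Q W X r R
    by (intro weak_type_of_Lp_bound[OF _ _ _ _ _ bound lower]) (auto simp: \<tau>_def intro!: fmeasurable.finite_UN)
  then have "\<tau> powr q * real (card X) * (r / 64) \<le> K powr q * (r / R) * (r / 64)"
    by (simp add: union Q power2_eq_square field_simps)
  then have "\<tau> powr q * real (card X) \<le> K powr q * (r / R)"
    by (rule mult_right_le_imp_le) (use r in simp)
  then have "real (card X) \<le> K powr q * (r / R) * (1 / \<tau>) powr q"
    using r R by (simp add: \<tau>_def powr_divide field_simps)
  also have "1 / \<tau> = 128 * (R / r)"
    by (simp add: \<tau>_def)
  also have "K powr q * (r / R) * (128 * (R / r)) powr q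
      = (128 * K) powr q * ((R / r) powr q / (R / r))"
    using r R K by (simp add: powr_mult powr_divide field_simps)
  also have "(R / r) powr q / (R / r) = (R / r) powr (q - 1)"
    using r R by (simp add: powr_diff)
  finally show "real (card X) \<le> (128 * K) powr q * (R / r) powr (q - 1)" .
qed

section \<open>Admissible exponents and the quasi-Assouad dimension\<close>

lemma covering_num_pos:
  assumes "0 < r" "bounded A" "A \<noteq> {}"
  shows "1 \<le> covering_num r A"
proof -
  have "compact (closure A)"
    using assms(2) by simp
  then obtain X where X: "finite X" "closure A \<subseteq> (\<Union>x\<in>X. ball x r)"
    using assms(1) unfolding compact_eq_totally_bounded by meson
  have "A \<subseteq> (\<Union>x\<in>X. cball x r)"
    using closure_subset[of A] X(2) ball_subset_cball[of _ r] by blast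
  then have "\<exists>n X. finite X \<and> card X = n \<and> A \<subseteq> (\<Union>x\<in>X. cball x r)"
    using X(1) by blast
  then have "\<exists>X. finite X \<and> card X = covering_num r A \<and> A \<subseteq> (\<Union>x\<in>X. cball x r)"
    unfolding covering_num_def by (rule LeastI_ex)
  then obtain Y where "finite Y" "card Y = covering_num r A" "A \<subseteq> (\<Union>x\<in>Y. cball x r)"
    by blast
  then show ?thesis
    using assms(3) card_gt_0_iff[of Y] by fastforce
qed

definition admissible_exponent :: "'a::euclidean_space set \<Rightarrow> real \<Rightarrow> real \<Rightarrow> bool" where
  "admissible_exponent E \<gamma> \<alpha> \<longleftrightarrow> (\<exists>C>0. \<forall>r R. 0 < r \<and> r < r powr (1 - \<gamma>) \<and> r powr (1 - \<gamma>) < R \<longrightarrow>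
     (\<forall>x\<in>E. real (covering_num r (cball x R \<inter> E)) \<le> C * (R / r) powr \<alpha>))"

lemma less_powr_imp_less_one:
  fixes r :: real
  assumes "0 < r" "0 < \<gamma>" "r < r powr (1 - \<gamma>)"
  shows "r < 1"
proof (rule ccontr)
  assume "\<not> r < 1"
  then have "r powr (1 - \<gamma>) \<le> r powr 1"
    using assms by (intro powr_mono) auto
  with assms show False by simp
qed

text \<open>For \<open>r < 1\<close> a larger \<open>\<gamma>\<close> raises the threshold \<open>r powr (1 - \<gamma>)\<close> and so restricts fewer pairs of
  scales.\<close>

lemma admissible_exponent_mono:
  assumes "admissible_exponent E \<gamma> \<alpha>" "0 < \<gamma>" "\<gamma> \<le> \<gamma>'"
  shows "admissible_exponent E \<gamma>' \<alpha>"
proof -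
  obtain C where C: "0 < C" "\<And>r R x. 0 < r \<Longrightarrow> r < r powr (1 - \<gamma>) \<Longrightarrow> r powr (1 - \<gamma>) < R \<Longrightarrow> x \<in> E
      \<Longrightarrow> real (covering_num r (cball x R \<inter> E)) \<le> C * (R / r) powr \<alpha>"
    using assms(1) unfolding admissible_exponent_def by blast
  have "real (covering_num r (cball x R \<inter> E)) \<le> C * (R / r) powr \<alpha>"
    if r: "0 < r" "r < r powr (1 - \<gamma>')" "r powr (1 - \<gamma>') < R" and "x \<in> E" for r R x
  proof (rule C(2))
    have "r < 1" using less_powr_imp_less_one[OF r(1) _ r(2)] assms by simp
    then show "r < r powr (1 - \<gamma>)"
      using r(1) assms(2) powr_less_mono'[of r "1 - \<gamma>" 1] by simp
    have "r powr (1 - \<gamma>) \<le> r powr (1 - \<gamma>')"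
      using \<open>r < 1\<close> r(1) assms by (intro powr_mono') auto
    then show "r powr (1 - \<gamma>) < R" using r by simp
  qed (use that in auto)
  then show ?thesis
    unfolding admissible_exponent_def using C(1) by blast
qed

text \<open>Fix \<open>r = 1/2\<close> and let \<open>R\<close> tend to infinity: with a negative exponent the bound would tend to \<open>0\<close>,
  but covering numbers of non-empty sets are at least \<open>1\<close>.\<close>

lemma admissible_exponent_nonneg:
  assumes adm: "admissible_exponent E \<gamma> \<alpha>" and "x \<in> E" "0 < \<gamma>" "\<gamma> < 1"
  shows "0 \<le> \<alpha>"
proof (rule ccontr)
  assume "\<not> 0 \<le> \<alpha>"
  obtain C where C: "0 < C" "\<And>r R. 0 < r \<Longrightarrow> r < r powr (1 - \<gamma>) \<Longrightarrow> r powr (1 - \<gamma>) < R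
      \<Longrightarrow> real (covering_num r (cball x R \<inter> E)) \<le> C * (R / r) powr \<alpha>"
    using adm \<open>x \<in> E\<close> unfolding admissible_exponent_def by blast
  have "((\<lambda>t. C * t powr \<alpha>) \<longlongrightarrow> C * 0) at_top"
    using \<open>\<not> 0 \<le> \<alpha>\<close> by (intro tendsto_mult tendsto_const tendsto_neg_powr filterlim_ident) auto
  then have "\<forall>\<^sub>F t in at_top. C * t powr \<alpha> < 1"
    by (rule order_tendstoD) simp
  then obtain t where t: "2 \<le> t" "C * t powr \<alpha> < 1"
    using eventually_happens[OF eventually_conj[OF eventually_ge_at_top[of 2]]] by auto
  have "(1/2::real) powr 1 < (1/2) powr (1 - \<gamma>)" "(1/2::real) powr (1 - \<gamma>) < 1"
    using assms powr_less_mono'[of "1/2::real" "1 - \<gamma>" 1] powr_less_mono'[of "1/2::real" 0 "1 - \<gamma>"]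
    by simp_all
  then have "real (covering_num (1/2) (cball x (t/2) \<inter> E)) \<le> C * t powr \<alpha>"
    using C(2)[of "1/2" "t/2"] t by simp
  moreover have "x \<in> cball x (t/2) \<inter> E"
    using \<open>x \<in> E\<close> t by simp
  then have "1 \<le> covering_num (1/2) (cball x (t/2) \<inter> E)"
    by (intro covering_num_pos bounded_Int) (simp, simp, blast)
  ultimately show False
    using t by linarith
qed

text \<open>The point is that the limit defining the dimension exists: on \<open>(0,1)\<close> the exponents are antitone
  in \<open>\<gamma>\<close> and at most \<open>d\<close>, so they converge to their supremum as \<open>\<gamma>\<close> tends to \<open>0\<close>.\<close>

lemma quasi_Assouad_dim_le:
  assumes "E \<noteq> {}"
    and adm: "\<And>\<gamma> \<alpha>. 0 < \<gamma> \<Longrightarrow> \<gamma> < 1 \<Longrightarrow> d < \<alpha> \<Longrightarrow> admissible_exponent E \<gamma> \<alpha>"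
  shows "quasi_Assouad_dim E \<le> d"
proof -
  let ?h = "qA_exponent E"
  have h_def: "?h \<gamma> = Inf (Collect (admissible_exponent E \<gamma>))" for \<gamma>
    by (simp add: qA_exponent_def admissible_exponent_def[abs_def])
  have bdd: "bdd_below (Collect (admissible_exponent E \<gamma>))" if "0 < \<gamma>" "\<gamma> < 1" for \<gamma>
    using admissible_exponent_nonneg[of E \<gamma>] that \<open>E \<noteq> {}\<close> by (intro bdd_belowI[of _ 0]) auto
  have le: "?h \<gamma> \<le> d" if "0 < \<gamma>" "\<gamma> < 1" for \<gamma>
  proof (rule field_le_epsilon)
    fix \<eta> :: real assume "0 < \<eta>"
    then show "?h \<gamma> \<le> d + \<eta>"
      unfolding h_def using that adm bdd by (intro cInf_lower) auto
  qed
  have anti: "?h \<gamma>' \<le> ?h \<gamma>" if "0 < \<gamma>" "\<gamma> \<le> \<gamma>'" "\<gamma>' < 1" for \<gamma> \<gamma>'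
    unfolding h_def
  proof (rule cInf_superset_mono)
    show "Collect (admissible_exponent E \<gamma>) \<noteq> {}"
      using adm[of \<gamma> "d + 1"] that by (auto intro!: exI[of _ "d + 1"])
    show "bdd_below (Collect (admissible_exponent E \<gamma>'))"
      using bdd that by simp
    show "Collect (admissible_exponent E \<gamma>) \<subseteq> Collect (admissible_exponent E \<gamma>')"
      using admissible_exponent_mono that by blast
  qed
  define L where "L = Sup (?h ` {0<..<1})"
  have bdd_h: "bdd_above (?h ` {0<..<1})"
    using le by (intro bdd_aboveI[of _ d]) auto
  have near0: "\<forall>\<^sub>F \<gamma> in at_right 0. \<gamma> \<in> {0<..<\<delta>}" if "0 < \<delta>" for \<delta> :: real
    using that eventually_at_right_real by blast
  have "(?h \<longlongrightarrow> L) (at_right 0)"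
  proof (rule increasing_tendsto)
    show "\<forall>\<^sub>F \<gamma> in at_right 0. ?h \<gamma> \<le> L"
      using near0[of 1] by (rule eventually_mono) (auto simp: L_def intro!: cSup_upper bdd_h)
  next
    fix x assume "x < L"
    then obtain \<gamma> where \<gamma>: "\<gamma> \<in> {0<..<1}" "x < ?h \<gamma>"
      unfolding L_def using less_cSup_iff[OF _ bdd_h, of x] by auto
    show "\<forall>\<^sub>F \<gamma>' in at_right 0. x < ?h \<gamma>'"
    proof (rule eventually_mono)
      show "\<forall>\<^sub>F \<gamma>' in at_right 0. \<gamma>' \<in> {0<..<\<gamma>}"
        using near0 \<gamma> by simp
      show "x < ?h \<gamma>'" if "\<gamma>' \<in> {0<..<\<gamma>}" for \<gamma>'
        using anti[of \<gamma>' \<gamma>] that \<gamma> by simp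
    qed
  qed
  then have "quasi_Assouad_dim E = L"
    using \<open>E \<noteq> {}\<close> by (simp add: quasi_Assouad_dim_def tendsto_Lim)
  also have "L \<le> d"
    unfolding L_def using le by (intro cSup_least) auto
  finally show ?thesis .
qed

section \<open>The lower bound for the integrability exponent\<close>

theorem proposition3p2:
  fixes s :: real and \<Theta> :: "(real^2) set" and p :: ennreal
  assumes "0 \<le> s" and "s \<le> 1"
    and "\<Theta> \<subseteq> sphere 0 1"
    and "quasi_Assouad_dim \<Theta> = s"
    and "1 \<le> p"
    and "\<And>\<epsilon>::real. \<epsilon> > 0 \<Longrightarrow> \<exists>C\<ge>1. \<forall>\<delta>\<in>{0<..<1}. \<forall>f\<in>Lp_space p lebesgue.
      Lp_norm p lebesgue (nikodym_max \<Theta> \<delta> f)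
        \<le> ennreal (C * \<delta> powr (-\<epsilon>)) * Lp_norm p lebesgue (\<lambda>x. ennreal \<bar>f x\<bar>)"
  shows "p \<ge> ennreal (1 + s)"
proof (cases "\<Theta> = {} \<or> p = \<infinity>")
  case True
  then show ?thesis
    using assms(4,5) by (auto simp: quasi_Assouad_dim_def)
next
  case False
  then obtain q where p: "p = ennreal q" "1 \<le> q"
    using assms(5) by (cases p) auto
  have "admissible_exponent \<Theta> \<gamma> \<alpha>" if \<gamma>: "0 < \<gamma>" "\<gamma> < 1" and \<alpha>: "q - 1 < \<alpha>" for \<gamma> \<alpha>
  proof -
    \<comment> \<open>Chosen so that \<open>r powr (- \<epsilon> q) = (r powr (- \<gamma>)) powr (\<alpha> - (q - 1))\<close>, which
      \<open>r powr (- \<gamma>) < R / r\<close> bounds by the missing power of \<open>R / r\<close>.\<close>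
    define \<epsilon> where "\<epsilon> = \<gamma> * (\<alpha> - (q - 1)) / q"
    have "\<epsilon> > 0"
      using \<gamma> \<alpha> p(2) by (simp add: \<epsilon>_def)
    then obtain C where C: "1 \<le> C" "\<And>\<delta> f. 0 < \<delta> \<Longrightarrow> \<delta> < 1 \<Longrightarrow> f \<in> Lp_space (ennreal q) lebesgue \<Longrightarrow>
        Lp_norm (ennreal q) lebesgue (nikodym_max \<Theta> \<delta> f)
          \<le> ennreal (C * \<delta> powr (-\<epsilon>)) * Lp_norm (ennreal q) lebesgue (\<lambda>x. ennreal \<bar>f x\<bar>)"
      using assms(6)[of \<epsilon>] unfolding p(1) by auto
    have "real (covering_num r (cball x R \<inter> \<Theta>)) \<le> (128 * C) powr q * (R / r) powr \<alpha>"
      if r: "0 < r" "r < r powr (1 - \<gamma>)" "r powr (1 - \<gamma>) < R" and x: "x \<in> \<Theta>" for r R x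
    proof -
      have "r < 1" using less_powr_imp_less_one[OF r(1) \<gamma>(1) r(2)] .
      have "real (covering_num r (cball x R \<inter> \<Theta>))
          \<le> (128 * (C * r powr (-\<epsilon>))) powr q * (R / r) powr (q - 1)"
        using C r \<open>r < 1\<close> p(2)
        by (intro covering_num_directions_le[OF assms(3) x]) auto
      also have "(128 * (C * r powr (-\<epsilon>))) powr q = (128 * C) powr q * r powr (- \<epsilon> * q)"
        using C(1) by (simp add: powr_mult powr_powr)
      also have "r powr (- \<epsilon> * q) = (r powr (- \<gamma>)) powr (\<alpha> - (q - 1))"
        using p(2) by (simp add: powr_powr \<epsilon>_def)
      also have "r powr (- \<gamma>) = r powr (1 - \<gamma>) / r"
        using r(1) by (simp add: powr_diff powr_minus field_simps)
      also have "(128 * C) powr q * (r powr (1 - \<gamma>) / r) powr (\<alpha> - (q - 1)) * (R / r) powr (q - 1)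
          \<le> (128 * C) powr q * (R / r) powr (\<alpha> - (q - 1)) * (R / r) powr (q - 1)"
        using r \<alpha> C(1)
        by (intro mult_right_mono mult_left_mono powr_mono2 divide_right_mono) auto
      also have "\<dots> = (128 * C) powr q * (R / r) powr \<alpha>"
        by (simp add: mult.assoc flip: powr_add)
      finally show ?thesis .
    qed
    moreover have "0 < (128 * C) powr q"
      using C(1) by simp
    ultimately show ?thesis
      unfolding admissible_exponent_def by blast
  qed
  then have "s \<le> q - 1"
    using quasi_Assouad_dim_le[of \<Theta> "q - 1"] False assms(4) by auto
  then show ?thesis
    unfolding p(1) by (intro ennreal_leI) simp
qed

end
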